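(* The commutative monoids $(\mathcal{A},+)$, $(\mathcal{M},\cdot)$ and $(\mathcal{I}_0,\cdot)$ are pairwise isomorphic, via bijections that respect the binary operations and that carry the additive functional equation $f(xy)=f(x)+f(y)$ (for coprime $x,y$) of elements of $\mathcal{A}$ to the multiplicative functional equation $g(xy)=g(x)g(y)$ (for coprime $x,y$) of elements of $\mathcal{M}$ and $\mathcal{I}_0$, respectively. Likewise, the commutative semigroups $(\mathcal{A}_0,+)$, $(\mathcal{M}_1,\cdot)$ and $(\mathcal{I}_{01},\cdot)$ are pairwise isomorphic in the same sense.
   Context: $\mathbb{N}$ is the set of positive integers. Arithmetic functions are functions $\mathbb{N}\to\mathbb{R}$; $+$ and $\cdot$ denote pointwise sum and product. $f$ is additive if $f(xy)=f(x)+f(y)$ for all coprime $x,y\in\mathbb{N}$; $g$ is multiplicative if $g$ is not identically zero and $g(xy)=g(x)g(y)$ for all coprime $x,y\in\mathbb{N}$. In the following sets, the inequalities are required for all $x\in\mathbb{N}$ with $x>1$: $\mathcal{A}=\{f\text{ additive}: f(x)\ge0\}$, $\mathcal{A}_0=\{f\in\mathcal{A}: f(x)>0\}$; $\mathcal{M}=\{g\text{ multiplicative}: g(x)\ge1\}$, $\mathcal{M}_1=\{g\in\mathcal{M}: g(x)>1\}$; $\mathcal{I}_0=\{h\text{ multiplicative}: 0<h(x)\le1\}$, $\mathcal{I}_{01}=\{h\text{ multiplicative}: 0<h(x)<1\}$. *)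

theory Defs
  imports Complex_Main "HOL-Algebra.Group"
begin

text \<open>
  Arithmetic functions live on the positive integers.  They are represented by functions
  on \<^typ>\<open>nat\<close> that are extensional on \<open>{0<..}\<close> (their value at \<open>0\<close> is the fixed junk value
  \<^const>\<open>undefined\<close>), so that equality of representatives is equality on the positive integers.
\<close>

definition arith_funs :: "(nat \<Rightarrow> real) set" where
  "arith_funs = {0<..} \<rightarrow>\<^sub>E UNIV"

definition additive_fun :: "(nat \<Rightarrow> real) \<Rightarrow> bool" where
  "additive_fun f \<longleftrightarrow> (\<forall>x>0. \<forall>y>0. coprime x y \<longrightarrow> f (x * y) = f x + f y)"

definition multiplicative_fun :: "(nat \<Rightarrow> real) \<Rightarrow> bool" where
  "multiplicative_fun g \<longleftrightarrow>
     (\<exists>x>0. g x \<noteq> 0) \<and> (\<forall>x>0. \<forall>y>0. coprime x y \<longrightarrow> g (x * y) = g x * g y)"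

definition set_A :: "(nat \<Rightarrow> real) set" where
  "set_A = {f \<in> arith_funs. additive_fun f \<and> (\<forall>x>1. f x \<ge> 0)}"

definition set_A0 :: "(nat \<Rightarrow> real) set" where
  "set_A0 = {f \<in> set_A. \<forall>x>1. f x > 0}"

definition set_M :: "(nat \<Rightarrow> real) set" where
  "set_M = {g \<in> arith_funs. multiplicative_fun g \<and> (\<forall>x>1. g x \<ge> 1)}"

definition set_M1 :: "(nat \<Rightarrow> real) set" where
  "set_M1 = {g \<in> set_M. \<forall>x>1. g x > 1}"

definition set_I0 :: "(nat \<Rightarrow> real) set" where
  "set_I0 = {h \<in> arith_funs. multiplicative_fun h \<and> (\<forall>x>1. 0 < h x \<and> h x \<le> 1)}"

definition set_I01 :: "(nat \<Rightarrow> real) set" where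
  "set_I01 = {h \<in> arith_funs. multiplicative_fun h \<and> (\<forall>x>1. 0 < h x \<and> h x < 1)}"

text \<open>
  For the sets that are only semigroups, the \<^const>\<open>one\<close> field of the record below need not lie in the
  carrier; \<^const>\<open>hom\<close>, \<^const>\<open>iso\<close> and \<open>comm_semigroup_struct\<close> do not refer to it.
\<close>

definition pointwise_add :: "(nat \<Rightarrow> real) set \<Rightarrow> (nat \<Rightarrow> real) monoid" where
  "pointwise_add S =
     \<lparr>carrier = S, mult = (\<lambda>f g. \<lambda>x\<in>{0<..}. f x + g x), one = (\<lambda>x\<in>{0<..}. 0)\<rparr>"

definition pointwise_mult :: "(nat \<Rightarrow> real) set \<Rightarrow> (nat \<Rightarrow> real) monoid" where
  "pointwise_mult S =
     \<lparr>carrier = S, mult = (\<lambda>f g. \<lambda>x\<in>{0<..}. f x * g x), one = (\<lambda>x\<in>{0<..}. 1)\<rparr>"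

definition comm_semigroup_struct :: "('a, 'b) monoid_scheme \<Rightarrow> bool" where
  "comm_semigroup_struct G \<longleftrightarrow>
     (\<forall>x\<in>carrier G. \<forall>y\<in>carrier G. x \<otimes>\<^bsub>G\<^esub> y \<in> carrier G) \<and>
     (\<forall>x\<in>carrier G. \<forall>y\<in>carrier G. \<forall>z\<in>carrier G.
        (x \<otimes>\<^bsub>G\<^esub> y) \<otimes>\<^bsub>G\<^esub> z = x \<otimes>\<^bsub>G\<^esub> (y \<otimes>\<^bsub>G\<^esub> z)) \<and>
     (\<forall>x\<in>carrier G. \<forall>y\<in>carrier G. x \<otimes>\<^bsub>G\<^esub> y = y \<otimes>\<^bsub>G\<^esub> x)"

text \<open>
  \<open>\<Phi>\<close> carries the functional equation \<open>f (x y) = p (f x) (f y)\<close> of the elements \<open>f\<close> of \<open>S\<close> to the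
  functional equation \<open>(\<Phi> f) (x y) = q ((\<Phi> f) x) ((\<Phi> f) y)\<close>: a single map \<open>\<phi>\<close> on values sends the
  left-hand side of the former to the left-hand side of the latter, and likewise for the
  right-hand sides.  Merely asking that \<open>\<Phi> f\<close> satisfy the second equation would add nothing to
  \<open>\<Phi>\<close> mapping into a set of functions that all satisfy it.
\<close>

definition carries_equation ::
  "(real \<Rightarrow> real \<Rightarrow> real) \<Rightarrow> (real \<Rightarrow> real \<Rightarrow> real) \<Rightarrow>
   ((nat \<Rightarrow> real) \<Rightarrow> (nat \<Rightarrow> real)) \<Rightarrow> (nat \<Rightarrow> real) set \<Rightarrow> bool" where
  "carries_equation p q \<Phi> S \<longleftrightarrow>
     (\<exists>\<phi>. \<forall>f\<in>S. \<forall>x>0. \<forall>y>0. coprime x y \<longrightarrow>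
        \<phi> (f (x * y)) = \<Phi> f (x * y) \<and> \<phi> (p (f x) (f y)) = q (\<Phi> f x) (\<Phi> f y))"

end

theory Submission
  imports Defs
begin

text \<open>
  Additive functions vanish at \<open>1\<close>, and multiplicative functions take the value \<open>1\<close> there.  Hence
  each of the six sets consists of the solutions \<open>f\<close> of \<open>f (x y) = p (f x) (f y)\<close> whose value at
  \<open>1\<close> is the neutral element of the commutative monoid operation \<open>p\<close> and whose other values lie in
  a set \<open>V\<close> closed under \<open>p\<close>.  Composition with a bijection \<open>V \<rightarrow> W\<close> that respects the operations
  and the neutral elements is then an isomorphism; the bijections are \<open>exp x\<close>, \<open>exp (- x)\<close> and
  \<open>inverse x\<close>.
\<close>

text \<open>The value at 1 is fixed apart from \<open>V\<close> because \<open>V\<close> need not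
  contain \<open>e\<close>: the strict inequalities of the three semigroups exclude it.\<close>

definition coprime_solutions ::
  "(real \<Rightarrow> real \<Rightarrow> real) \<Rightarrow> real \<Rightarrow> real set \<Rightarrow> (nat \<Rightarrow> real) set" where
  "coprime_solutions p e V =
     {f \<in> arith_funs. f 1 = e \<and> (\<forall>x>0. \<forall>y>0. coprime x y \<longrightarrow> f (x * y) = p (f x) (f y)) \<and>
       (\<forall>x>1. f x \<in> V)}"

definition pointwise_op ::
  "(real \<Rightarrow> real \<Rightarrow> real) \<Rightarrow> real \<Rightarrow> (nat \<Rightarrow> real) set \<Rightarrow> (nat \<Rightarrow> real) monoid" where
  "pointwise_op p e S =
     \<lparr>carrier = S, mult = (\<lambda>f g. \<lambda>x\<in>{0<..}. p (f x) (g x)), one = (\<lambda>x\<in>{0<..}. e)\<rparr>"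

text \<open>The restriction keeps the default value at 0, which plain composition with
  \<open>\<phi>\<close> would replace by \<open>\<phi> undefined\<close>.\<close>

definition lift_values :: "(real \<Rightarrow> real) \<Rightarrow> (nat \<Rightarrow> real) \<Rightarrow> (nat \<Rightarrow> real)" where
  "lift_values \<phi> f = (\<lambda>x\<in>{0<..}. \<phi> (f x))"

lemma pointwise_add_eq: "pointwise_add = pointwise_op (+) 0"
  by (simp add: fun_eq_iff pointwise_add_def pointwise_op_def)

lemma pointwise_mult_eq: "pointwise_mult = pointwise_op (*) 1"
  by (simp add: fun_eq_iff pointwise_mult_def pointwise_op_def)

text \<open>The number 1 is coprime to itself, so f(1) = f(1) + f(1).\<close>

lemma additive_fun_iff:
  "additive_fun f \<longleftrightarrow>
     f 1 = 0 \<and> (\<forall>x>0. \<forall>y>0. coprime x y \<longrightarrow> f (x * y) = f x + f y)"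
proof -
  have "f 1 = 0" if "additive_fun f"
  proof -
    have "f (1 * 1) = f 1 + f 1"
      using that unfolding additive_fun_def by (metis coprime_1_left zero_less_one)
    then show ?thesis by simp
  qed
  then show ?thesis unfolding additive_fun_def by blast
qed

text \<open>At a point x with g(x) nonzero, g(x) cancels from g(x) = g(x) g(1). Conversely, 1 is a
  point where g does not vanish.\<close>

lemma multiplicative_fun_iff:
  "multiplicative_fun g \<longleftrightarrow>
     g 1 = 1 \<and> (\<forall>x>0. \<forall>y>0. coprime x y \<longrightarrow> g (x * y) = g x * g y)"
proof
  assume g: "multiplicative_fun g"
  then obtain x where x: "x > 0" "g x \<noteq> 0"
    unfolding multiplicative_fun_def by blast
  have "g (x * 1) = g x * g 1"
    using g x(1) unfolding multiplicative_fun_def by (metis coprime_1_right zero_less_one)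
  then have "g 1 = 1" using x(2) by simp
  then show "g 1 = 1 \<and> (\<forall>x>0. \<forall>y>0. coprime x y \<longrightarrow> g (x * y) = g x * g y)"
    using g unfolding multiplicative_fun_def by blast
next
  assume g: "g 1 = 1 \<and> (\<forall>x>0. \<forall>y>0. coprime x y \<longrightarrow> g (x * y) = g x * g y)"
  then have "\<exists>x>0. g x \<noteq> 0" by (intro exI[of _ 1]) simp
  with g show "multiplicative_fun g" unfolding multiplicative_fun_def by blast
qed

lemma set_A_eq: "set_A = coprime_solutions (+) 0 {0..}"
  unfolding set_A_def coprime_solutions_def additive_fun_iff by auto

lemma set_A0_eq: "set_A0 = coprime_solutions (+) 0 {0<..}"
  unfolding set_A0_def set_A_def coprime_solutions_def additive_fun_iff
  by (auto intro: less_imp_le)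

lemma set_M_eq: "set_M = coprime_solutions (*) 1 {1..}"
  unfolding set_M_def coprime_solutions_def multiplicative_fun_iff by auto

lemma set_M1_eq: "set_M1 = coprime_solutions (*) 1 {1<..}"
  unfolding set_M1_def set_M_def coprime_solutions_def multiplicative_fun_iff
  by (auto intro: less_imp_le)

lemma set_I0_eq: "set_I0 = coprime_solutions (*) 1 {0<..1}"
  unfolding set_I0_def coprime_solutions_def multiplicative_fun_iff by auto

lemma set_I01_eq: "set_I01 = coprime_solutions (*) 1 {0<..<1}"
  unfolding set_I01_def coprime_solutions_def multiplicative_fun_iff by auto

lemma coprime_solutions_value:
  assumes "f \<in> coprime_solutions p e V" "x > 0"
  shows "f x \<in> insert e V"
  using assms by (cases "x = 1") (auto simp: coprime_solutions_def)

text \<open>At 0 both functions have the same default value, so agreement on the positive integers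
  suffices.\<close>

lemma coprime_solutions_eqI:
  assumes "f \<in> coprime_solutions p e V" "g \<in> coprime_solutions q e' W"
    and "\<And>x. x > 0 \<Longrightarrow> f x = g x"
  shows "f = g"
proof (rule extensionalityI)
  show "f \<in> extensional {0<..}" "g \<in> extensional {0<..}"
    using assms(1,2) by (auto simp: coprime_solutions_def arith_funs_def PiE_def)
qed (use assms(3) in auto)

lemma carrier_pointwise_op [simp]: "carrier (pointwise_op p e S) = S"
  by (simp add: pointwise_op_def)

text \<open>Applying \<open>\<phi>\<close> to both sides of the equation of f gives the equation of
  the lift. The law \<open>hom\<close> ranges over \<open>insert e V\<close> since x or y may be
  1.\<close>

lemma lift_values_in_coprime_solutions:
  assumes f: "f \<in> coprime_solutions p e V"
    and e: "\<phi> e = e'" and V: "\<And>a. a \<in> V \<Longrightarrow> \<phi> a \<in> W"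
    and hom: "\<And>a b. a \<in> insert e V \<Longrightarrow> b \<in> insert e V \<Longrightarrow> \<phi> (p a b) = q (\<phi> a) (\<phi> b)"
  shows "lift_values \<phi> f \<in> coprime_solutions q e' W"
proof -
  have "\<phi> (f (x * y)) = q (\<phi> (f x)) (\<phi> (f y))" if "x > 0" "y > 0" "coprime x y" for x y
    using f that hom[OF coprime_solutions_value[OF f] coprime_solutions_value[OF f]]
    by (simp add: coprime_solutions_def)
  then show ?thesis
    using f e V by (auto simp: coprime_solutions_def lift_values_def arith_funs_def)
qed

text \<open>The lifts of \<open>\<phi>\<close> and \<open>\<psi>\<close> are mutually inverse; that
  \<open>\<psi>\<close> respects the operations too puts its lifts into \<open>A\<close>, which
  gives surjectivity. The map on values demanded by \<open>carries_equation\<close> is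
  \<open>\<phi>\<close> itself.\<close>

lemma lift_values_iso:
  fixes p q :: "real \<Rightarrow> real \<Rightarrow> real" and e e' :: real and V W :: "real set"
  defines "A \<equiv> coprime_solutions p e V" and "B \<equiv> coprime_solutions q e' W"
  assumes \<phi>e: "\<phi> e = e'" and \<phi>V: "\<And>a. a \<in> V \<Longrightarrow> \<phi> a \<in> W"
    and \<phi>hom: "\<And>a b. a \<in> insert e V \<Longrightarrow> b \<in> insert e V \<Longrightarrow> \<phi> (p a b) = q (\<phi> a) (\<phi> b)"
    and \<psi>e: "\<psi> e' = e" and \<psi>W: "\<And>a. a \<in> W \<Longrightarrow> \<psi> a \<in> V"
    and \<psi>hom: "\<And>a b. a \<in> insert e' W \<Longrightarrow> b \<in> insert e' W \<Longrightarrow> \<psi> (q a b) = p (\<psi> a) (\<psi> b)"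
    and \<psi>\<phi>: "\<And>a. a \<in> V \<Longrightarrow> \<psi> (\<phi> a) = a" and \<phi>\<psi>: "\<And>a. a \<in> W \<Longrightarrow> \<phi> (\<psi> a) = a"
  shows "\<exists>\<Phi> \<in> iso (pointwise_op p e A) (pointwise_op q e' B). carries_equation p q \<Phi> A"
proof
  have \<Phi>: "lift_values \<phi> f \<in> B" if "f \<in> A" for f
    using that \<phi>e \<phi>V \<phi>hom unfolding A_def B_def
    by (rule lift_values_in_coprime_solutions[where \<phi> = \<phi> and p = p and e = e and V = V])
  have \<Psi>: "lift_values \<psi> g \<in> A" if "g \<in> B" for g
    using that \<psi>e \<psi>W \<psi>hom unfolding A_def B_def
    by (rule lift_values_in_coprime_solutions[where \<phi> = \<psi> and p = q and e = e' and V = W])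
  have \<Psi>\<Phi>: "lift_values \<psi> (lift_values \<phi> f) = f" if "f \<in> A" for f
  proof (rule coprime_solutions_eqI)
    show "lift_values \<psi> (lift_values \<phi> f) \<in> coprime_solutions p e V" "f \<in> coprime_solutions p e V"
      using \<Psi>[OF \<Phi>[OF that]] that by (simp_all add: A_def)
    fix x :: nat
    assume "x > 0"
    with coprime_solutions_value that have "f x \<in> insert e V" unfolding A_def by blast
    then show "lift_values \<psi> (lift_values \<phi> f) x = f x"
      using \<open>x > 0\<close> \<phi>e \<psi>e \<psi>\<phi> by (auto simp: lift_values_def)
  qed
  have \<Phi>\<Psi>: "lift_values \<phi> (lift_values \<psi> g) = g" if "g \<in> B" for g
  proof (rule coprime_solutions_eqI)
    show "lift_values \<phi> (lift_values \<psi> g) \<in> coprime_solutions q e' W"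
      "g \<in> coprime_solutions q e' W"
      using \<Phi>[OF \<Psi>[OF that]] that by (simp_all add: B_def)
    fix x :: nat
    assume "x > 0"
    with coprime_solutions_value that have "g x \<in> insert e' W" unfolding B_def by blast
    then show "lift_values \<phi> (lift_values \<psi> g) x = g x"
      using \<open>x > 0\<close> \<phi>e \<psi>e \<phi>\<psi> by (auto simp: lift_values_def)
  qed
  \<comment> \<open>Two functions and two points serve both goals: x = y gives the homomorphism law,
    f = g the transport of the functional equation.\<close>
  have hom: "\<phi> (p (f x) (g y)) = q (\<phi> (f x)) (\<phi> (g y))"
    if "f \<in> A" "g \<in> A" "x > 0" "y > 0" for f g x y
    using that coprime_solutions_value unfolding A_def by (intro \<phi>hom) blast+
  have "bij_betw (lift_values \<phi>) A B"
    by (rule bij_betw_byWitness[where f' = "lift_values \<psi>"]) (use \<Phi> \<Psi> \<Psi>\<Phi> \<Phi>\<Psi> in auto)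
  then show "lift_values \<phi> \<in> iso (pointwise_op p e A) (pointwise_op q e' B)"
    using \<Phi> hom by (auto simp: iso_def hom_def pointwise_op_def lift_values_def fun_eq_iff restrict_def)
  show "carries_equation p q (lift_values \<phi>) A"
    unfolding carries_equation_def using hom by (intro exI[of _ \<phi>]) (auto simp: lift_values_def)
qed

text \<open>The functional equation survives by the interchange law p (p a b) (p c d) = p (p a c) (p
  b d), a consequence of associativity and commutativity; \<open>p e e = e\<close> settles the value
  at 1.\<close>

lemma pointwise_op_closed:
  assumes p: "abel_semigroup p" and e: "p e e = e"
    and V: "\<And>a b. a \<in> V \<Longrightarrow> b \<in> V \<Longrightarrow> p a b \<in> V"
    and f: "f \<in> coprime_solutions p e V" and g: "g \<in> coprime_solutions p e V"
  shows "(\<lambda>x\<in>{0<..}. p (f x) (g x)) \<in> coprime_solutions p e V"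
proof -
  interpret abel_semigroup p by (rule p)
  show ?thesis
    using e V f g by (auto simp: coprime_solutions_def arith_funs_def ac_simps)
qed

lemma comm_semigroup_struct_pointwise_op:
  assumes p: "abel_semigroup p" and e: "p e e = e"
    and V: "\<And>a b. a \<in> V \<Longrightarrow> b \<in> V \<Longrightarrow> p a b \<in> V"
  shows "comm_semigroup_struct (pointwise_op p e (coprime_solutions p e V))"
proof -
  interpret abel_semigroup p by (rule p)
  show ?thesis
    using pointwise_op_closed[OF p e V]
    by (auto simp: comm_semigroup_struct_def pointwise_op_def fun_eq_iff restrict_def ac_simps)
qed

text \<open>With e in \<open>V\<close>, the constant function e lies in the carrier and is the
  identity.\<close>

lemma comm_monoid_pointwise_op:
  assumes p: "abel_semigroup p" and e: "\<And>a. p e a = a" and eV: "e \<in> V"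
    and V: "\<And>a b. a \<in> V \<Longrightarrow> b \<in> V \<Longrightarrow> p a b \<in> V"
  shows "comm_monoid (pointwise_op p e (coprime_solutions p e V))"
proof -
  let ?G = "pointwise_op p e (coprime_solutions p e V)"
  have S: "comm_semigroup_struct ?G"
    using p e V by (rule comm_semigroup_struct_pointwise_op)
  have one: "\<one>\<^bsub>?G\<^esub> \<in> coprime_solutions p e V"
    using e eV by (auto simp: coprime_solutions_def pointwise_op_def arith_funs_def)
  have l_one: "\<one>\<^bsub>?G\<^esub> \<otimes>\<^bsub>?G\<^esub> f = f" if "f \<in> coprime_solutions p e V" for f
  proof (rule coprime_solutions_eqI)
    show "\<one>\<^bsub>?G\<^esub> \<otimes>\<^bsub>?G\<^esub> f \<in> coprime_solutions p e V" "f \<in> coprime_solutions p e V"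
      using S one that by (simp_all add: comm_semigroup_struct_def)
  qed (simp add: e pointwise_op_def)
  show ?thesis
  proof (rule comm_monoidI)
    show "\<one>\<^bsub>?G\<^esub> \<in> carrier ?G" using one by simp
    show "\<one>\<^bsub>?G\<^esub> \<otimes>\<^bsub>?G\<^esub> f = f" if "f \<in> carrier ?G" for f
      using l_one that by simp
  qed (use S[unfolded comm_semigroup_struct_def] in blast)+
qed

theorem proposition3p5:
  shows
    "(comm_monoid (pointwise_add set_A) \<and>
      comm_monoid (pointwise_mult set_M) \<and>
      comm_monoid (pointwise_mult set_I0) \<and>
      (\<exists>\<Phi> \<in> iso (pointwise_add set_A) (pointwise_mult set_M). carries_equation (+) (*) \<Phi> set_A) \<and>
      (\<exists>\<Phi> \<in> iso (pointwise_add set_A) (pointwise_mult set_I0). carries_equation (+) (*) \<Phi> set_A) \<and>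
      (\<exists>\<Phi> \<in> iso (pointwise_mult set_M) (pointwise_mult set_I0). carries_equation (*) (*) \<Phi> set_M))
     \<and>
     (comm_semigroup_struct (pointwise_add set_A0) \<and>
      comm_semigroup_struct (pointwise_mult set_M1) \<and>
      comm_semigroup_struct (pointwise_mult set_I01) \<and>
      (\<exists>\<Phi> \<in> iso (pointwise_add set_A0) (pointwise_mult set_M1). carries_equation (+) (*) \<Phi> set_A0) \<and>
      (\<exists>\<Phi> \<in> iso (pointwise_add set_A0) (pointwise_mult set_I01). carries_equation (+) (*) \<Phi> set_A0) \<and>
      (\<exists>\<Phi> \<in> iso (pointwise_mult set_M1) (pointwise_mult set_I01). carries_equation (*) (*) \<Phi> set_M1))"
proof -
  have add: "abel_semigroup ((+) :: real \<Rightarrow> real \<Rightarrow> real)"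
    and mult: "abel_semigroup ((*) :: real \<Rightarrow> real \<Rightarrow> real)"
    by (rule add.abel_semigroup_axioms, rule mult.abel_semigroup_axioms)
  have mult_ge: "a * b \<ge> 1" if "a \<ge> 1" "b \<ge> 1" for a b :: real
    using mult_mono[OF that] that by simp
  have mult_gt: "a * b > 1" if "a > 1" "b > 1" for a b :: real
    using that by (rule less_1_mult)
  have mult_lt: "a * b < 1" if "0 < a" "a < 1" "0 < b" "b < 1" for a b :: real
    using mult_strict_mono[OF that(2,4)] that by simp
  show ?thesis
    unfolding set_A_eq set_A0_eq set_M_eq set_M1_eq set_I0_eq set_I01_eq
      pointwise_add_eq pointwise_mult_eq
  proof (intro conjI)
    show "comm_monoid (pointwise_op (+) 0 (coprime_solutions (+) 0 {0..}))"
      by (rule comm_monoid_pointwise_op[OF add]) (auto)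
    show "comm_monoid (pointwise_op (*) 1 (coprime_solutions (*) 1 {1..}))"
      by (rule comm_monoid_pointwise_op[OF mult]) (auto intro: mult_ge)
    show "comm_monoid (pointwise_op (*) 1 (coprime_solutions (*) 1 {0<..1}))"
      by (rule comm_monoid_pointwise_op[OF mult]) (auto intro: mult_le_one)
    \<comment> \<open>The logarithm turns products into sums here because its arguments are at least
      1, hence positive.\<close>
    show "\<exists>\<Phi> \<in> iso (pointwise_op (+) 0 (coprime_solutions (+) 0 {0..}))
      (pointwise_op (*) 1 (coprime_solutions (*) 1 {1..})).
      carries_equation (+) (*) \<Phi> (coprime_solutions (+) 0 {0..})"
      by (rule lift_values_iso[where \<phi> = "exp" and \<psi> = "ln"])
      (auto simp: exp_add ln_mult)
    \<comment> \<open>The sign reverses the order, so the half-line from 0 is mapped onto (0, 1] and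
      0 still goes to 1.\<close>
    show "\<exists>\<Phi> \<in> iso (pointwise_op (+) 0 (coprime_solutions (+) 0 {0..}))
      (pointwise_op (*) 1 (coprime_solutions (*) 1 {0<..1})).
      carries_equation (+) (*) \<Phi> (coprime_solutions (+) 0 {0..})"
      by (rule lift_values_iso[where \<phi> = "\<lambda>a. exp (- a)" and \<psi> = "\<lambda>a. - ln a"])
      (auto simp: mult_exp_exp ln_mult)
    \<comment> \<open>Going from b back to ln b and on to exp (- ln b) yields 1/b, which is its own
      inverse map.\<close>
    show "\<exists>\<Phi> \<in> iso (pointwise_op (*) 1 (coprime_solutions (*) 1 {1..}))
      (pointwise_op (*) 1 (coprime_solutions (*) 1 {0<..1})).
      carries_equation (*) (*) \<Phi> (coprime_solutions (*) 1 {1..})"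
      by (rule lift_values_iso[where \<phi> = "inverse" and \<psi> = "inverse"])
      (auto simp: inverse_le_1_iff inverse_less_1_iff one_le_inverse_iff one_less_inverse_iff)
    \<comment> \<open>From here on the same three maps are used: they preserve strictness, matching
      the open ranges, and still send neutral element to neutral element at the point 1.\<close>
    show "comm_semigroup_struct (pointwise_op (+) 0 (coprime_solutions (+) 0 {0<..}))"
      by (rule comm_semigroup_struct_pointwise_op[OF add]) (auto)
    show "comm_semigroup_struct (pointwise_op (*) 1 (coprime_solutions (*) 1 {1<..}))"
      by (rule comm_semigroup_struct_pointwise_op[OF mult]) (auto intro: mult_gt)
    show "comm_semigroup_struct (pointwise_op (*) 1 (coprime_solutions (*) 1 {0<..<1}))"
      by (rule comm_semigroup_struct_pointwise_op[OF mult]) (auto intro: mult_lt)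
    show "\<exists>\<Phi> \<in> iso (pointwise_op (+) 0 (coprime_solutions (+) 0 {0<..}))
      (pointwise_op (*) 1 (coprime_solutions (*) 1 {1<..})).
      carries_equation (+) (*) \<Phi> (coprime_solutions (+) 0 {0<..})"
      by (rule lift_values_iso[where \<phi> = "exp" and \<psi> = "ln"])
      (auto simp: exp_add ln_mult)
    show "\<exists>\<Phi> \<in> iso (pointwise_op (+) 0 (coprime_solutions (+) 0 {0<..}))
      (pointwise_op (*) 1 (coprime_solutions (*) 1 {0<..<1})).
      carries_equation (+) (*) \<Phi> (coprime_solutions (+) 0 {0<..})"
      by (rule lift_values_iso[where \<phi> = "\<lambda>a. exp (- a)" and \<psi> = "\<lambda>a. - ln a"])
      (auto simp: mult_exp_exp ln_mult)
    show "\<exists>\<Phi> \<in> iso (pointwise_op (*) 1 (coprime_solutions (*) 1 {1<..}))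
      (pointwise_op (*) 1 (coprime_solutions (*) 1 {0<..<1})).
      carries_equation (*) (*) \<Phi> (coprime_solutions (*) 1 {1<..})"
      by (rule lift_values_iso[where \<phi> = "inverse" and \<psi> = "inverse"])
      (auto simp: inverse_le_1_iff inverse_less_1_iff one_le_inverse_iff one_less_inverse_iff)
  qed
qed

end
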